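(* Let $\varphi: T\to T$ be such that $C_\varphi$ is bounded on $\mathcal{L}_0$, and let $\lambda\in\mathbb{C}$. Then the operator $C_\varphi-\lambda$ on $\mathcal{L}_0$ has dense range if one of the following cases occurs: (1) $|\lambda|<1$ and $\varphi$ is injective; (2) $|\lambda|>1$; (3) $\lambda\ne 0$ and for every $w\in T$ the set $\varphi^{-n}(\{w\})$ is empty for some $n\in\mathbb{N}$.
   Context: $T$ is an infinite, locally finite tree (connected graph without cycles, identified with its vertex set) with a chosen root $o$, in which every vertex except possibly $o$ has degree greater than $1$. $d(v,w)$ is the number of edges of the unique path joining $v$ and $w$, and $|v|=d(o,v)$. $T^*=T\setminus\{o\}$. For $v\in T^*$, the parent $v^-$ is the neighbor of $v$ on the path from $o$ to $v$. The Lipschitz space $\mathcal{L}$ is the set of $f:T\to\mathbb{C}$ with $\sup_{v\in T^*}|f(v)-f(v^-)|<\infty$, a Banach space under $\|f\|_{\mathcal{L}}=\max\{|f(o)|,\sup_{v\in T^*}|f(v)-f(v^-)|\}$. The little Lipschitz space $\mathcal{L}_0$ is the closed subspace of $f\in\mathcal{L}$ with $\lim_{|v|\to\infty}|f(v)-f(v^-)|=0$. The composition operator is $C_\varphi f=f\circ\varphi$; it is bounded on $\mathcal{L}_0$ if it maps $\mathcal{L}_0$ into itself and is a bounded operator there. $\varphi^n$ is the $n$-fold iterate of $\varphi$ and $\varphi^{-n}(\{w\})=\{u\in T:\varphi^n(u)=w\}$. $\mathbb{N}=\{1,2,3,\dots\}$. *)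

theory Defs
  imports "HOL-Analysis.Analysis"
begin

definition is_path :: "('a \<Rightarrow> 'a \<Rightarrow> bool) \<Rightarrow> 'a \<Rightarrow> 'a list \<Rightarrow> 'a \<Rightarrow> bool" where
  "is_path adj v p w \<longleftrightarrow>
     p \<noteq> [] \<and> hd p = v \<and> last p = w \<and> distinct p \<and> successively adj p"

definition is_cycle :: "('a \<Rightarrow> 'a \<Rightarrow> bool) \<Rightarrow> 'a list \<Rightarrow> bool" where
  "is_cycle adj c \<longleftrightarrow>
     3 \<le> length c \<and> distinct c \<and> successively adj c \<and> adj (last c) (hd c)"

text \<open>The vertex set is the whole type \<open>'a\<close>; edges are given by a symmetric irreflexive
  adjacency relation.\<close>

locale graph_tree =
  fixes adj :: "'a \<Rightarrow> 'a \<Rightarrow> bool"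
  assumes adj_sym: "adj v w \<Longrightarrow> adj w v"
    and adj_irrefl: "\<not> adj v v"
    and connected: "\<exists>p. is_path adj v p w"
    and acyclic: "\<not> is_cycle adj c"
begin

definition path_between :: "'a \<Rightarrow> 'a \<Rightarrow> 'a list" where
  "path_between v w = (THE p. is_path adj v p w)"

definition tdist :: "'a \<Rightarrow> 'a \<Rightarrow> nat" where
  "tdist v w = length (path_between v w) - 1"

end

locale rooted_tree = graph_tree adj
  for adj :: "'a \<Rightarrow> 'a \<Rightarrow> bool" +
  fixes root :: 'a
  assumes infinite_vertices: "infinite (UNIV :: 'a set)"
    and locally_finite: "finite {w. adj v w}"
    and degree_gt_1: "v \<noteq> root \<Longrightarrow> 1 < card {w. adj v w}"
begin

definition level :: "'a \<Rightarrow> nat" where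
  "level v = tdist root v"

text \<open>Only meaningful for \<open>v \<noteq> root\<close>.\<close>

definition parent :: "'a \<Rightarrow> 'a" where
  "parent v = (THE u. adj v u \<and> u \<in> set (path_between root v))"

definition lipschitz_space :: "('a \<Rightarrow> complex) set" where
  "lipschitz_space = {f. bdd_above ((\<lambda>v. cmod (f v - f (parent v))) ` (UNIV - {root}))}"

definition lipschitz_norm :: "('a \<Rightarrow> complex) \<Rightarrow> real" where
  "lipschitz_norm f =
     max (cmod (f root)) (SUP v\<in>UNIV - {root}. cmod (f v - f (parent v)))"

text \<open>The filter \<open>filtercomap level at_top\<close> expresses \<open>|v| \<rightarrow> \<infinity>\<close>; since the root has level 0,
  the junk value \<open>parent root\<close> plays no role in the limit.\<close>

definition little_lipschitz_space :: "('a \<Rightarrow> complex) set" where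
  "little_lipschitz_space =
     {f \<in> lipschitz_space.
        ((\<lambda>v. cmod (f v - f (parent v))) \<longlongrightarrow> 0) (filtercomap level at_top)}"

definition bounded_on_little_lipschitz ::
    "(('a \<Rightarrow> complex) \<Rightarrow> ('a \<Rightarrow> complex)) \<Rightarrow> bool" where
  "bounded_on_little_lipschitz A \<longleftrightarrow>
     A ` little_lipschitz_space \<subseteq> little_lipschitz_space \<and>
     (\<exists>K. \<forall>f\<in>little_lipschitz_space. lipschitz_norm (A f) \<le> K * lipschitz_norm f)"

definition dense_range_on_little_lipschitz ::
    "(('a \<Rightarrow> complex) \<Rightarrow> ('a \<Rightarrow> complex)) \<Rightarrow> bool" where
  "dense_range_on_little_lipschitz A \<longleftrightarrow>
     (\<forall>g\<in>little_lipschitz_space. \<forall>\<epsilon>>0. \<exists>h\<in>A ` little_lipschitz_space.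
        lipschitz_norm (\<lambda>v. h v - g v) < \<epsilon>)"

end

text \<open>Linearity is not a conjunct of \<open>bounded_on_little_lipschitz\<close>: it is automatic for
  composition operators.\<close>

definition comp_op :: "('a \<Rightarrow> 'a) \<Rightarrow> ('a \<Rightarrow> complex) \<Rightarrow> ('a \<Rightarrow> complex)" where
  "comp_op \<phi> f = f \<circ> \<phi>"

end

theory Submission
  imports Defs
begin

text \<open>Finitely supported functions are dense in the little Lipschitz space: since
  \<open>f v = o(|v|)\<close>, multiplying \<open>f\<close> by a cutoff that decreases linearly to 0 over many
  levels changes it little in norm. So it suffices to approximate the indicator
  \<open>\<chi> w\<close> of a vertex. With \<open>C = C\<^sub>\<phi>\<close> and \<open>\<mu> = 1 / \<lambda>\<close>, the operator \<open>C - \<lambda>\<close> maps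
  \<open>- (\<Sum>k<n. \<mu> ^ (k + 1) * C ^ k (\<chi> w))\<close> to \<open>\<chi> w - \<mu> ^ n * C ^ n (\<chi> w)\<close>. The error is 0 for
  suitable \<open>n\<close> in case (3) and tends to 0 in case (2), because indicators of sets have norm
  at most 1. If \<open>\<phi>\<close> is injective, then \<open>C (\<chi> (\<phi> u)) = \<chi> u\<close>, so \<open>C - \<lambda>\<close> maps
  \<open>\<Sum>k<n. \<lambda> ^ k * \<chi> (\<phi> ^ (k + 1) w)\<close> to \<open>\<chi> w - \<lambda> ^ n * \<chi> (\<phi> ^ n w)\<close>, whose error term
  tends to 0 in case (1).\<close>

section \<open>Uniqueness of paths in a tree\<close>

context graph_tree
begin

lemma is_path_Cons:
  assumes "is_path adj v (v # p) w" "p \<noteq> []"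
  shows "is_path adj (hd p) p w" "adj v (hd p)"
  using assms by (auto simp: is_path_def successively_Cons)

lemma is_path_same_ends:
  assumes "is_path adj v p v"
  shows "p = [v]"
  using assms by (cases p) (auto simp: is_path_def split: if_splits)

text \<open>Two paths that separate at \<open>v\<close> and meet again, first at \<open>x\<close>, enclose a cycle.\<close>

lemma paths_same_second:
  assumes p: "is_path adj v (v # p) w" and q: "is_path adj v (v # q) w"
    and ne: "p \<noteq> []" "q \<noteq> []"
  shows "hd p = hd q"
proof (rule ccontr)
  assume hd: "hd p \<noteq> hd q"
  have "w \<in> set p" "w \<in> set q"
    using p q ne last_in_set[of p] last_in_set[of q] by (auto simp: is_path_def)
  then have "\<exists>x\<in>set p. x \<in> set q" by blast
  \<comment> \<open>Taking \<open>x\<close> to be the first vertex of \<open>p\<close> that lies on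
    \<open>q\<close> keeps \<open>a\<close> disjoint from \<open>q\<close>, so the closed walk
    \<open>?c\<close> repeats no vertex.\<close>
  then obtain a x b where a: "p = a @ x # b" "x \<in> set q" "\<forall>y\<in>set a. y \<notin> set q"
    using split_list_first_propE[of p "\<lambda>x. x \<in> set q"] by metis
  then obtain c d where c: "q = c @ x # d"
    by (meson split_list)
  let ?c = "v # a @ x # rev c"
  have pp: "distinct (v # a @ x # b)" "successively adj (v # a @ x # b)"
    using p by (auto simp: is_path_def a)
  have qq: "distinct (v # c @ x # d)" "successively adj (v # c @ x # d)"
    using q by (auto simp: is_path_def c)
  have "successively adj (c @ [x])"
    using qq by (auto simp: successively_append_iff successively_Cons)
  then have "successively (\<lambda>u v. adj v u) (c @ [x])"
    by (rule successively_mono) (auto intro: adj_sym)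
  then have xc: "successively adj (x # rev c)"
    using successively_rev[of adj "c @ [x]"] by simp
  then have s: "successively adj ?c"
    using pp(2) successively_append_iff[of adj "v # a" "x # b"]
      successively_append_iff[of adj "v # a" "x # rev c"] by auto
  have "distinct ?c"
    using pp qq a c by auto
  \<comment> \<open>If \<open>a\<close> and \<open>c\<close> were both empty, \<open>p\<close> and
    \<open>q\<close> would both start with \<open>x\<close>, contrary to \<open>hd\<close>.\<close>
  moreover have "3 \<le> length ?c"
    using hd a c by (cases a; cases c) auto
  moreover have "adj (last ?c) (hd ?c)"
  proof -
    have "last ?c = hd q" by (cases c) (auto simp: c)
    moreover have "adj v (hd q)" using is_path_Cons(2)[OF q ne(2)] .
    ultimately show ?thesis by (simp add: adj_sym)
  qed
  ultimately show False
    using s acyclic unfolding is_cycle_def by blast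
qed

text \<open>Induction along the first path: since the second vertices agree, the tails are again
  paths with common ends. If one path is a single vertex, then \<open>v = w\<close> and distinctness
  forces both to be \<open>[v]\<close>.\<close>

lemma path_unique:
  assumes "is_path adj v p w" "is_path adj v q w"
  shows "p = q"
  using assms
proof (induction p arbitrary: v q)
  case Nil
  then show ?case by (simp add: is_path_def)
next
  case (Cons x p)
  have x: "x = v" using Cons.prems(1) by (simp add: is_path_def)
  obtain q' where q: "q = v # q'"
    using Cons.prems(2) by (cases q) (auto simp: is_path_def)
  show ?case
  proof (cases "p = [] \<or> q' = []")
    case True
    then have "v = w" using Cons.prems q x by (auto simp: is_path_def)
    then have "x # p = [v]" "q = [v]" using Cons.prems is_path_same_ends by blast+
    then show ?thesis by simp
  next
    case False
    have paths: "is_path adj v (v # p) w" "is_path adj v (v # q') w"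
      using Cons.prems q x by simp_all
    have "hd p = hd q'"
      using paths_same_second[OF paths] False by blast
    moreover have "is_path adj (hd p) p w" "is_path adj (hd q') q' w"
      using is_path_Cons(1)[OF paths(1)] is_path_Cons(1)[OF paths(2)] False by blast+
    ultimately have "p = q'" using Cons.IH by metis
    then show ?thesis using q x by simp
  qed
qed

lemma path_between_eqI: "is_path adj v p w \<Longrightarrow> path_between v w = p"
  unfolding path_between_def by (blast intro: path_unique)

lemma is_path_path_between: "is_path adj v (path_between v w) w"
  using connected path_between_eqI by metis

end

section \<open>Parents, levels and finiteness of balls\<close>

context rooted_tree
begin

text \<open>Dropping the last vertex of the path from \<open>root\<close> to \<open>v\<close> leaves
  the path to the penultimate vertex, which is thus one level lower and proves to be the
  parent.\<close>

lemma parent_edge: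
  assumes "v \<noteq> root"
  shows "adj (parent v) v \<and> level v = Suc (level (parent v))"
proof -
  let ?p = "path_between root v"
  have p: "is_path adj root ?p v" by (rule is_path_path_between)
  define q where "q = butlast ?p"
  have pq: "?p = q @ [v]"
    using p by (metis append_butlast_last_id is_path_def q_def)
  have q0: "q \<noteq> []" using p pq assms by (auto simp: is_path_def)
  let ?u = "last q"
  have qp: "is_path adj root q ?u" and qv: "adj ?u v"
    using p q0 unfolding pq is_path_def by (auto simp: successively_append_iff)
  \<comment> \<open>A neighbour \<open>u\<close> of \<open>v\<close> on the path permits a jump from
    \<open>u\<close> straight to \<open>v\<close>; by uniqueness of paths nothing was skipped, so
    \<open>u\<close> is penultimate.\<close>
  have uniq: "u = ?u" if u: "adj v u" "u \<in> set ?p" for u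
  proof -
    have "u \<in> set q" using u pq adj_irrefl by auto
    then obtain a b where ab: "q = a @ u # b" by (meson split_list)
    have "is_path adj root (a @ [u, v]) v"
      using p adj_sym[OF u(1)] successively_append_iff[of adj a "u # b @ [v]"]
        successively_append_iff[of adj a "[u, v]"]
      unfolding pq ab is_path_def by (cases a) auto
    then have "?p = a @ [u, v]" by (rule path_between_eqI)
    then show ?thesis by (simp add: pq)
  qed
  have "parent v = ?u"
    unfolding parent_def
    using uniq qv q0 pq by (intro the_equality) (auto intro: adj_sym)
  moreover have "level v = length q" by (simp add: level_def tdist_def pq)
  moreover have "level ?u = length q - 1"
    by (simp add: level_def tdist_def path_between_eqI[OF qp])
  ultimately show ?thesis using qv q0 by (cases q) auto
qed

lemma level_eq_0_iff: "level v = 0 \<longleftrightarrow> v = root"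
proof
  have "is_path adj root [root] root" by (simp add: is_path_def)
  then show "level v = 0" if "v = root"
    using path_between_eqI by (simp add: that level_def tdist_def)
qed (use parent_edge in force)

text \<open>Induction on the radius: a vertex one level further out is a neighbour of its parent in
  the smaller ball, and the tree is locally finite.\<close>

lemma finite_ball: "finite {v. level v \<le> n}"
proof (induction n)
  case 0
  then show ?case by (simp add: level_eq_0_iff)
next
  case (Suc n)
  have "{v. level v \<le> Suc n} \<subseteq> insert root (\<Union>u\<in>{v. level v \<le> n}. {w. adj u w})"
    using parent_edge by force
  then show ?case
    using Suc locally_finite by (meson finite.insertI finite_UN finite_subset)
qed

section \<open>The little Lipschitz space as a vector space\<close>

text \<open>The value at \<open>root\<close> involves the unspecified \<open>parent root\<close>,
  which is why the norm estimates ask for \<open>v \<noteq> root\<close>.\<close>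

abbreviation grad :: "('a \<Rightarrow> complex) \<Rightarrow> 'a \<Rightarrow> complex" where
  "grad f v \<equiv> f v - f (parent v)"

lemma bounded_grad_if_eventually:
  assumes "\<And>v. level v \<ge> N \<Longrightarrow> cmod (grad f v) \<le> c"
  shows "f \<in> lipschitz_space"
proof -
  let ?B = "(\<lambda>v. cmod (grad f v)) ` {v. level v \<le> N}"
  have "(\<lambda>v. cmod (grad f v)) ` (UNIV - {root}) \<subseteq> ?B \<union> {..c}"
    using assms nat_le_linear by fastforce
  moreover have "bdd_above (?B \<union> {..c})"
    by (simp add: finite_ball)
  ultimately show ?thesis
    unfolding lipschitz_space_def mem_Collect_eq by (rule bdd_above_mono[rotated])
qed

text \<open>A gradient tending to 0 is bounded off a finite ball, hence everywhere. Membership thus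
  becomes a single limit, and closure under linear operations is inherited from the limit
  rules.\<close>

lemma little_lipschitz_iff:
  "f \<in> little_lipschitz_space \<longleftrightarrow> (grad f \<longlongrightarrow> 0) (filtercomap level at_top)"
proof -
  have "f \<in> lipschitz_space" if "(grad f \<longlongrightarrow> 0) (filtercomap level at_top)"
  proof -
    have "\<forall>\<^sub>F v in filtercomap level at_top. cmod (grad f v) < 1"
      using that by (auto simp: tendsto_iff)
    then obtain N where "\<And>v. level v \<ge> N \<Longrightarrow> cmod (grad f v) < 1"
      by (auto simp: eventually_filtercomap_at_top_linorder)
    then show ?thesis by (intro bounded_grad_if_eventually[of N f 1]) (simp add: less_imp_le)
  qed
  then show ?thesis
    unfolding little_lipschitz_space_def by (auto simp: tendsto_norm_zero_iff)
qed

lemma little_lipschitz_imp_lipschitz: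
  "f \<in> little_lipschitz_space \<Longrightarrow> f \<in> lipschitz_space"
  by (simp add: little_lipschitz_space_def)

lemma little_lipschitz_0: "(\<lambda>v. 0) \<in> little_lipschitz_space"
  by (simp add: little_lipschitz_iff)

lemma little_lipschitz_add:
  assumes "f \<in> little_lipschitz_space" "g \<in> little_lipschitz_space"
  shows "(\<lambda>v. f v + g v) \<in> little_lipschitz_space"
  using tendsto_add[OF assms[unfolded little_lipschitz_iff]]
  by (simp add: little_lipschitz_iff algebra_simps)

lemma little_lipschitz_scale:
  assumes "f \<in> little_lipschitz_space"
  shows "(\<lambda>v. c * f v) \<in> little_lipschitz_space"
  using tendsto_mult_left[OF assms[unfolded little_lipschitz_iff], of c]
  by (simp add: little_lipschitz_iff algebra_simps)

lemma little_lipschitz_diff: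
  assumes "f \<in> little_lipschitz_space" "g \<in> little_lipschitz_space"
  shows "(\<lambda>v. f v - g v) \<in> little_lipschitz_space"
  using little_lipschitz_add[OF assms(1) little_lipschitz_scale[OF assms(2), of "-1"]] by simp

lemma little_lipschitz_sum:
  assumes "\<And>i. i \<in> I \<Longrightarrow> f i \<in> little_lipschitz_space"
  shows "(\<lambda>v. \<Sum>i\<in>I. f i v) \<in> little_lipschitz_space"
  using assms
proof (induction I rule: infinite_finite_induct)
  case (insert i I)
  have "(\<lambda>v. f i v + (\<Sum>i\<in>I. f i v)) \<in> little_lipschitz_space"
    by (rule little_lipschitz_add) (simp_all add: insert)
  then show ?case using insert.hyps by simp
qed (simp_all add: little_lipschitz_0)

lemma finite_support_little_lipschitz:
  assumes "finite {v. f v \<noteq> 0}"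
  shows "f \<in> little_lipschitz_space"
proof -
  obtain N where N: "\<And>v. f v \<noteq> 0 \<Longrightarrow> level v \<le> N"
    using finite_imageI[OF assms, of level] by (auto simp: finite_nat_set_iff_bounded_le)
  \<comment> \<open>The offset 2 rather than 1 puts the parent, too, strictly above level
    \<open>N\<close>.\<close>
  have "grad f v = 0" if "level v \<ge> N + 2" for v
  proof -
    have "v \<noteq> root" using that level_eq_0_iff[of v] by auto
    then have "level (parent v) > N" using parent_edge[of v] that by auto
    then have "f (parent v) = 0" "f v = 0" using N[of "parent v"] N[of v] that by auto
    then show ?thesis by simp
  qed
  then have "\<forall>\<^sub>F v in filtercomap level at_top. grad f v = 0"
    by (auto simp: eventually_filtercomap_at_top_linorder)
  then show ?thesis
    unfolding little_lipschitz_iff by (rule tendsto_eventually)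
qed

section \<open>Estimates for the Lipschitz norm\<close>

text \<open>Bounding the supremum in \<open>lipschitz_norm\<close> by \<open>cSUP_least\<close>
  requires a nonempty index set.\<close>

lemma ex_nonroot: "UNIV - {root} \<noteq> {}"
  using infinite_remove[OF infinite_vertices, of root] by (metis finite.emptyI)

lemma lipschitz_norm_leI:
  assumes "cmod (f root) \<le> c" "\<And>v. v \<noteq> root \<Longrightarrow> cmod (grad f v) \<le> c"
  shows "lipschitz_norm f \<le> c"
  unfolding lipschitz_norm_def using assms ex_nonroot by (auto intro!: cSUP_least)

lemma cmod_root_le_norm: "cmod (f root) \<le> lipschitz_norm f"
  by (simp add: lipschitz_norm_def)

lemma cmod_grad_le_norm:
  assumes "f \<in> lipschitz_space" "v \<noteq> root"
  shows "cmod (grad f v) \<le> lipschitz_norm f"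
proof -
  have "cmod (grad f v) \<le> (SUP v\<in>UNIV - {root}. cmod (grad f v))"
    using assms by (intro cSUP_upper) (auto simp: lipschitz_space_def)
  then show ?thesis by (simp add: lipschitz_norm_def)
qed

lemma lipschitz_norm_add_le:
  assumes "f \<in> lipschitz_space" "g \<in> lipschitz_space"
  shows "lipschitz_norm (\<lambda>v. f v + g v) \<le> lipschitz_norm f + lipschitz_norm g"
proof (rule lipschitz_norm_leI)
  show "cmod (f root + g root) \<le> lipschitz_norm f + lipschitz_norm g"
    by (meson add_mono cmod_root_le_norm norm_triangle_le)
  fix v assume "v \<noteq> root"
  then have "cmod (grad f v + grad g v) \<le> lipschitz_norm f + lipschitz_norm g"
    by (meson add_mono assms cmod_grad_le_norm norm_triangle_le)
  then show "cmod (f v + g v - (f (parent v) + g (parent v))) \<le> lipschitz_norm f + lipschitz_norm g"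
    by (simp add: algebra_simps)
qed

lemma lipschitz_norm_scale_le:
  assumes "f \<in> lipschitz_space"
  shows "lipschitz_norm (\<lambda>v. c * f v) \<le> cmod c * lipschitz_norm f"
proof (rule lipschitz_norm_leI)
  show "cmod (c * f root) \<le> cmod c * lipschitz_norm f"
    by (simp add: norm_mult mult_left_mono cmod_root_le_norm)
  fix v assume "v \<noteq> root"
  then have "cmod (c * grad f v) \<le> cmod c * lipschitz_norm f"
    by (simp add: norm_mult mult_left_mono cmod_grad_le_norm assms)
  then show "cmod (c * f v - c * f (parent v)) \<le> cmod c * lipschitz_norm f"
    by (simp add: algebra_simps)
qed

text \<open>Along an edge an indicator jumps by at most 1, whatever the set. As the bound is uniform
  in \<open>A\<close>, it also covers infinite preimages under iterates.\<close>

lemma lipschitz_norm_scaled_indicator_le: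
  "lipschitz_norm (\<lambda>v. c * of_bool (v \<in> A)) \<le> cmod c"
  by (rule lipschitz_norm_leI) (auto simp: of_bool_def)

section \<open>Density of finitely supported functions\<close>

text \<open>Walking from \<open>v\<close> towards \<open>root\<close> until the finite ball of
  radius \<open>N\<close> costs at most \<open>e\<close> per edge; on the ball, the sum
  \<open>C\<close> of all \<open>cmod (f v)\<close> is a bound.\<close>

lemma linear_growth:
  assumes "e \<ge> 0" "\<And>v. level v \<ge> N \<Longrightarrow> cmod (grad f v) \<le> e"
  obtains C where "C \<ge> 0" "\<And>v. cmod (f v) \<le> C + e * level v"
proof -
  define C where "C = (\<Sum>v\<in>{v. level v \<le> N}. cmod (f v))"
  have C0: "C \<ge> 0" by (simp add: C_def sum_nonneg)
  have "cmod (f v) \<le> C + e * level v" for v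
  proof (induction "level v" arbitrary: v rule: less_induct)
    case less
    show ?case
    proof (cases "level v \<le> N")
      case True
      then have "cmod (f v) \<le> C"
        unfolding C_def using finite_ball by (intro member_le_sum) auto
      then show ?thesis using assms(1) by (simp add: add_increasing2)
    next
      case False
      then have "v \<noteq> root" using level_eq_0_iff[of v] by auto
      note lev = conjunct2[OF parent_edge[OF this]]
      have "cmod (f v) \<le> cmod (f (parent v)) + cmod (grad f v)"
        by (rule norm_triangle_sub)
      also have "\<dots> \<le> C + e * level (parent v) + e"
        using less[of "parent v"] assms(2)[of v] lev False by (intro add_mono) auto
      also have "\<dots> = C + e * level v" by (simp add: lev algebra_simps)
      finally show ?thesis .
    qed
  qed
  then show ?thesis using C0 that by blast
qed

lemma finite_support_dense:
  assumes f: "f \<in> little_lipschitz_space" and "\<epsilon> > 0"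
  obtains g where "finite {v. g v \<noteq> 0}" "lipschitz_norm (\<lambda>v. g v - f v) < \<epsilon>"
proof -
  \<comment> \<open>The estimate below ends at \<open>4 * e\<close>, half of
    \<open>\<epsilon>\<close>, which gives the strict inequality.\<close>
  define e where "e = \<epsilon> / 8"
  have e: "e > 0" using assms(2) by (simp add: e_def)
  have "\<forall>\<^sub>F v in filtercomap level at_top. cmod (grad f v) < e"
    using f e unfolding little_lipschitz_iff by (auto simp: tendsto_iff)
  then obtain N where N: "\<And>v. level v \<ge> N \<Longrightarrow> cmod (grad f v) \<le> e"
    by (auto simp: eventually_filtercomap_at_top_linorder intro: less_imp_le)
  obtain C where C: "C \<ge> 0" "\<And>v. cmod (f v) \<le> C + e * level v"
    using linear_growth[of e N f] e N by auto
  \<comment> \<open>\<open>M\<close> dominates \<open>N\<close> and \<open>C / e\<close>, so at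
    levels below \<open>N + M \<le> 2 * M\<close> linear growth gives
    \<open>cmod (f v) \<le> 3 * e * M\<close>. \<open>Suc\<close> makes division by \<open>M\<close>
    safe.\<close>
  define M where "M = Suc (max N (nat \<lceil>C / e\<rceil>))"
  have M: "real M > 0" "real N \<le> real M" by (auto simp: M_def)
  have "C / e \<le> real M" unfolding M_def by linarith
  then have MC: "C \<le> e * real M" using e by (simp add: field_simps)
  \<comment> \<open>The cutoff is 1 up to level \<open>N\<close> and then falls with slope
    \<open>- 1 / M\<close> to 0 at level \<open>N + M\<close>.\<close>
  define c :: "nat \<Rightarrow> real" where "c n = max 0 (min 1 (1 - (real n - N) / M))" for n
  have c1: "c n = 1" if "n \<le> N" for n using that M by (simp add: c_def divide_nonpos_pos)
  have c0: "c n = 0" if "n \<ge> N + M" for n using that M by (simp add: c_def field_simps)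
  have c01: "\<bar>c n - 1\<bar> \<le> 1" for n by (auto simp: c_def)
  have cd: "\<bar>c (Suc n) - c n\<bar> \<le> 1 / M" for n
  proof -
    have eq: "(real (Suc n) - N) / M = (real n - N) / M + 1 / M"
      by (simp add: add_divide_distrib diff_divide_distrib)
    have "\<bar>max 0 (min 1 (1 - (x + y))) - max 0 (min 1 (1 - x))\<bar> \<le> y"
      if "y \<ge> 0" for x y :: real
      using that by (auto simp: max_def min_def)
    from this[of "1 / M"] show ?thesis unfolding c_def eq by simp
  qed
  define g where "g v = f v * c (level v)" for v
  have "{v. g v \<noteq> 0} \<subseteq> {v. level v \<le> N + M}"
    using c0 nat_le_linear by (auto simp: g_def)
  then have fin: "finite {v. g v \<noteq> 0}"
    using finite_ball finite_subset by blast
  have "lipschitz_norm (\<lambda>v. g v - f v) \<le> 4 * e"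
  proof (rule lipschitz_norm_leI)
    have "level root = 0" by (simp add: level_eq_0_iff)
    then show "cmod (g root - f root) \<le> 4 * e" using e by (simp add: g_def c1)
    fix v assume "v \<noteq> root"
    note lev = conjunct2[OF parent_edge[OF this]]
    let ?u = "parent v"
    \<comment> \<open>Discrete product rule: one term carries the gradient of \<open>f\<close>, the
      other that of the cutoff.\<close>
    have eq: "grad (\<lambda>v. g v - f v) v =
        grad f v * of_real (c (level v) - 1) + f ?u * of_real (c (level v) - c (level ?u))"
      by (simp add: g_def algebra_simps)
    have 1: "cmod (grad f v) * \<bar>c (level v) - 1\<bar> \<le> e"
    proof (cases "level v \<le> N")
      case True
      then show ?thesis using c1 e by simp
    next
      case False
      then show ?thesis using mult_mono[OF N[of v] c01] e by simp
    qed
    \<comment> \<open>The slope \<open>1 / M\<close> cancels the factor \<open>M\<close> in the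
      growth bound for \<open>f\<close>; from level \<open>N + M\<close> on, the cutoff is
      constantly 0.\<close>
    have 2: "cmod (f ?u) * \<bar>c (level v) - c (level ?u)\<bar> \<le> 3 * e"
    proof (cases "level ?u \<ge> N + M")
      case True
      then show ?thesis using c0 lev e by simp
    next
      case False
      then have "real (level ?u) \<le> 2 * real M" using M by linarith
      then have "e * level ?u \<le> e * (2 * real M)" using e by (intro mult_left_mono) auto
      then have "cmod (f ?u) \<le> 3 * e * real M"
        using C(2)[of ?u] MC by linarith
      then have "cmod (f ?u) * \<bar>c (level v) - c (level ?u)\<bar> \<le> (3 * e * real M) * (1 / M)"
        using cd e unfolding lev by (intro mult_mono) auto
      then show ?thesis using M by simp
    qed
    show "cmod (grad (\<lambda>v. g v - f v) v) \<le> 4 * e"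
      unfolding eq
      by (rule order_trans[OF norm_triangle_ineq])
        (use add_mono[OF 1 2] in \<open>simp add: norm_mult del: of_real_diff\<close>)
  qed
  also have "\<dots> < \<epsilon>" using assms(2) by (simp add: e_def)
  finally show ?thesis using that fin by blast
qed

section \<open>Reduction to indicators of single vertices\<close>

text \<open>The functions in the closure of the range, collected in \<open>Cl\<close>, form a linear
  subspace. Containing the indicators, it contains all finitely supported functions, which are
  dense.\<close>

lemma dense_range_if_indicators:
  fixes A :: "('a \<Rightarrow> complex) \<Rightarrow> 'a \<Rightarrow> complex"
  assumes maps: "\<And>f. f \<in> little_lipschitz_space \<Longrightarrow> A f \<in> little_lipschitz_space"
    and add: "\<And>f g v. A (\<lambda>v. f v + g v) v = A f v + A g v"
    and scale: "\<And>c f v. A (\<lambda>v. c * f v) v = c * A f v"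
    and ind: "\<And>w \<epsilon>. \<epsilon> > 0 \<Longrightarrow> \<exists>h\<in>little_lipschitz_space.
                lipschitz_norm (\<lambda>v. A h v - of_bool (v = w)) < \<epsilon>"
  shows "dense_range_on_little_lipschitz A"
proof -
  define Cl where "Cl = {g \<in> little_lipschitz_space. \<forall>\<epsilon>>0. \<exists>h\<in>little_lipschitz_space.
                lipschitz_norm (\<lambda>v. A h v - g v) < \<epsilon>}"
  note lip = little_lipschitz_imp_lipschitz
  have Cl_add: "(\<lambda>v. f v + g v) \<in> Cl" if fg: "f \<in> Cl" "g \<in> Cl" for f g
  proof -
    have L: "f \<in> little_lipschitz_space" "g \<in> little_lipschitz_space"
      using fg by (auto simp: Cl_def)
    have "\<exists>h\<in>little_lipschitz_space. lipschitz_norm (\<lambda>v. A h v - (f v + g v)) < \<epsilon>"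
      if "\<epsilon> > 0" for \<epsilon> :: real
    proof -
      have "\<epsilon> / 2 > 0" using that by simp
      then obtain h k where h: "h \<in> little_lipschitz_space" "lipschitz_norm (\<lambda>v. A h v - f v) < \<epsilon> / 2"
        and k: "k \<in> little_lipschitz_space" "lipschitz_norm (\<lambda>v. A k v - g v) < \<epsilon> / 2"
        using fg unfolding Cl_def by blast
      have "lipschitz_norm (\<lambda>v. (A h v - f v) + (A k v - g v)) \<le>
          lipschitz_norm (\<lambda>v. A h v - f v) + lipschitz_norm (\<lambda>v. A k v - g v)"
        by (intro lipschitz_norm_add_le lip little_lipschitz_diff maps h k L)
      also have "\<dots> < \<epsilon>" using h(2) k(2) by simp
      finally have "lipschitz_norm (\<lambda>v. (A h v - f v) + (A k v - g v)) < \<epsilon>" .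
      moreover have "(\<lambda>v. (A h v - f v) + (A k v - g v)) = (\<lambda>v. A (\<lambda>v. h v + k v) v - (f v + g v))"
        by (simp add: add algebra_simps)
      ultimately show ?thesis using little_lipschitz_add[OF h(1) k(1)] by auto
    qed
    then show ?thesis using L by (simp add: Cl_def little_lipschitz_add)
  qed
  have Cl_scale: "(\<lambda>v. c * f v) \<in> Cl" if f: "f \<in> Cl" for c f
  proof -
    have L: "f \<in> little_lipschitz_space"
      using f by (auto simp: Cl_def)
    have "\<exists>h\<in>little_lipschitz_space. lipschitz_norm (\<lambda>v. A h v - c * f v) < \<epsilon>"
      if "\<epsilon> > 0" for \<epsilon> :: real
    proof -
      \<comment> \<open>Adding 1 allows for \<open>c = 0\<close> and makes the final estimate
        strict.\<close>
      have c: "cmod c + 1 > 0" by (simp add: add_nonneg_pos)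
      then have "\<epsilon> / (cmod c + 1) > 0" using that by simp
      then obtain h where h: "h \<in> little_lipschitz_space"
          "lipschitz_norm (\<lambda>v. A h v - f v) < \<epsilon> / (cmod c + 1)"
        using f unfolding Cl_def by blast
      have "lipschitz_norm (\<lambda>v. c * (A h v - f v)) \<le> cmod c * lipschitz_norm (\<lambda>v. A h v - f v)"
        by (intro lipschitz_norm_scale_le lip little_lipschitz_diff maps h L)
      also have "\<dots> \<le> cmod c * (\<epsilon> / (cmod c + 1))"
        using h by (intro mult_left_mono) auto
      also have "\<dots> < \<epsilon>" using c that by (simp add: field_simps)
      finally have "lipschitz_norm (\<lambda>v. A (\<lambda>v. c * h v) v - c * f v) < \<epsilon>"
        by (simp add: scale algebra_simps)
      then show ?thesis using little_lipschitz_scale[OF h(1)] by blast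
    qed
    then show ?thesis using L by (simp add: Cl_def little_lipschitz_scale)
  qed
  have Cl_ind: "(\<lambda>v. of_bool (v = w)) \<in> Cl" for w
    using ind by (auto simp: Cl_def intro: finite_support_little_lipschitz)
  have Cl_sum: "(\<lambda>v. \<Sum>w\<in>S. g w * of_bool (v = w)) \<in> Cl" if "finite S" for S and g :: "'a \<Rightarrow> complex"
    using that
  proof (induction S rule: finite_induct)
    case empty
    show ?case using Cl_scale[OF Cl_ind, of 0 root] by simp
  next
    case (insert w S)
    then show ?case using Cl_add[OF Cl_scale[OF Cl_ind] insert.IH]
      by (simp del: sum_mult_of_bool_eq)
  qed
  have Cl_fin: "g \<in> Cl" if fin: "finite {v. g v \<noteq> 0}" for g
  proof -
    have "(\<lambda>v. \<Sum>w\<in>{v. g v \<noteq> 0}. g w * of_bool (v = w)) = g"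
    proof
      fix v
      show "(\<Sum>w\<in>{v. g v \<noteq> 0}. g w * of_bool (v = w)) = g v"
        using fin by (cases "g v = 0") (simp_all add: Collect_conj_eq[symmetric] conj_commute cong: conj_cong)
    qed
    then show ?thesis using Cl_sum[OF fin, of g] by simp
  qed
  have "\<exists>h\<in>little_lipschitz_space. lipschitz_norm (\<lambda>v. A h v - f v) < \<epsilon>"
    if f: "f \<in> little_lipschitz_space" and "\<epsilon> > 0" for f \<epsilon>
  proof -
    have e: "\<epsilon> / 2 > 0" using that by simp
    obtain g where g: "finite {v. g v \<noteq> 0}" "lipschitz_norm (\<lambda>v. g v - f v) < \<epsilon> / 2"
      using finite_support_dense[OF f e] by blast
    from Cl_fin[OF g(1)] have gL: "g \<in> little_lipschitz_space"
      by (simp add: Cl_def)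
    from Cl_fin[OF g(1)] obtain h where h: "h \<in> little_lipschitz_space"
        "lipschitz_norm (\<lambda>v. A h v - g v) < \<epsilon> / 2"
      using e unfolding Cl_def by blast
    have "lipschitz_norm (\<lambda>v. (A h v - g v) + (g v - f v)) \<le>
        lipschitz_norm (\<lambda>v. A h v - g v) + lipschitz_norm (\<lambda>v. g v - f v)"
      by (intro lipschitz_norm_add_le lip little_lipschitz_diff maps h gL f)
    also have "\<dots> < \<epsilon>" using g(2) h(2) by simp
    finally show ?thesis using h(1) by auto
  qed
  then show ?thesis by (auto simp: dense_range_on_little_lipschitz_def)
qed

section \<open>Geometric sums for composition operators\<close>

context
  fixes \<phi> :: "'a \<Rightarrow> 'a" and lam :: complex
  assumes comp: "comp_op \<phi> ` little_lipschitz_space \<subseteq> little_lipschitz_space"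
begin

lemma comp_op_funpow_little_lipschitz:
  assumes "f \<in> little_lipschitz_space"
  shows "(\<lambda>v. f ((\<phi> ^^ n) v)) \<in> little_lipschitz_space"
proof (induction n)
  case 0
  then show ?case using assms by simp
next
  case (Suc n)
  then have "comp_op \<phi> (\<lambda>v. f ((\<phi> ^^ n) v)) \<in> little_lipschitz_space" using comp by blast
  then show ?case by (simp add: comp_op_def comp_def funpow_swap1)
qed

lemma dense_range_comp_op:
  assumes "\<And>w \<epsilon>. \<epsilon> > 0 \<Longrightarrow> \<exists>h\<in>little_lipschitz_space.
      lipschitz_norm (\<lambda>v. h (\<phi> v) - lam * h v - of_bool (v = w)) < \<epsilon>"
  shows "dense_range_on_little_lipschitz (\<lambda>f v. comp_op \<phi> f v - lam * f v)"
proof (rule dense_range_if_indicators)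
  show "(\<lambda>v. comp_op \<phi> f v - lam * f v) \<in> little_lipschitz_space"
    if "f \<in> little_lipschitz_space" for f
    using that comp by (intro little_lipschitz_diff little_lipschitz_scale) auto
  show "\<exists>h\<in>little_lipschitz_space.
      lipschitz_norm (\<lambda>v. comp_op \<phi> h v - lam * h v - of_bool (v = w)) < \<epsilon>" if "\<epsilon> > 0" for w \<epsilon>
    using assms[OF that, of w] by (simp add: comp_op_def)
qed (simp_all add: comp_op_def algebra_simps)

text \<open>A truncated Neumann series, which telescopes. The sets where
  \<open>(\<phi> ^^ k) v = w\<close> may be infinite, so the summands lie in the space because
  composition with \<open>\<phi>\<close> preserves it.\<close>

lemma geometric_backward:
  assumes "lam \<noteq> 0"
  obtains h where "h \<in> little_lipschitz_space"
    "\<And>v. h (\<phi> v) - lam * h v - of_bool (v = w)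
        = - ((1 / lam) ^ n) * of_bool (v \<in> (\<phi> ^^ n) -` {w})"
proof
  let ?h = "\<lambda>v. \<Sum>k<n. - ((1 / lam) ^ Suc k) * of_bool ((\<phi> ^^ k) v = w)"
  have "(\<lambda>v. of_bool (v = w)) \<in> little_lipschitz_space"
    by (rule finite_support_little_lipschitz) simp
  from comp_op_funpow_little_lipschitz[OF this]
  show "?h \<in> little_lipschitz_space"
    by (intro little_lipschitz_sum little_lipschitz_scale)
  fix v
  let ?t = "\<lambda>k. - ((1 / lam) ^ k) * of_bool ((\<phi> ^^ k) v = w) :: complex"
  have "?h (\<phi> v) - lam * ?h v = (\<Sum>k<n. ?t (Suc k) - ?t k)"
    using assms by (simp add: sum_distrib_left sum_subtractf sum_negf funpow_swap1)
  also have "\<dots> = ?t n - ?t 0" by (rule sum_lessThan_telescope)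
  finally show "?h (\<phi> v) - lam * ?h v - of_bool (v = w)
      = - ((1 / lam) ^ n) * of_bool (v \<in> (\<phi> ^^ n) -` {w})"
    by simp
qed

text \<open>Injectivity turns \<open>\<phi> v = (\<phi> ^^ Suc k) w\<close> into
  \<open>v = (\<phi> ^^ k) w\<close>. Composition thus lowers the index by one while multiplication
  by \<open>lam\<close> raises the power, and the difference telescopes.\<close>

lemma geometric_forward:
  assumes "inj \<phi>"
  obtains h where "h \<in> little_lipschitz_space"
    "\<And>v. h (\<phi> v) - lam * h v - of_bool (v = w)
        = - (lam ^ n) * of_bool (v \<in> {(\<phi> ^^ n) w})"
proof
  let ?h = "\<lambda>v. \<Sum>k<n. lam ^ k * of_bool (v = (\<phi> ^^ Suc k) w)"
  show "?h \<in> little_lipschitz_space"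
    by (intro little_lipschitz_sum little_lipschitz_scale finite_support_little_lipschitz) simp
  fix v
  let ?t = "\<lambda>k. - (lam ^ k) * of_bool (v = (\<phi> ^^ k) w) :: complex"
  have "?h (\<phi> v) - lam * ?h v = (\<Sum>k<n. ?t (Suc k) - ?t k)"
    using assms by (simp add: sum_distrib_left sum_subtractf sum_negf inj_eq mult.assoc
        del: sum_mult_of_bool_eq sum_of_bool_mult_eq)
  also have "\<dots> = ?t n - ?t 0" by (rule sum_lessThan_telescope)
  finally show "?h (\<phi> v) - lam * ?h v - of_bool (v = w)
      = - (lam ^ n) * of_bool (v \<in> {(\<phi> ^^ n) w})"
    by simp
qed

section \<open>Dense range in the three cases\<close>

text \<open>The forward sum involves no division by \<open>lam\<close>, so \<open>lam = 0\<close> is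
  covered as well.\<close>

lemma dense_range_inj:
  assumes "cmod lam < 1" "inj \<phi>"
  shows "dense_range_on_little_lipschitz (\<lambda>f v. comp_op \<phi> f v - lam * f v)"
proof (rule dense_range_comp_op)
  fix w and \<epsilon> :: real assume "\<epsilon> > 0"
  then obtain n where "cmod lam ^ n < \<epsilon>"
    using assms(1) real_arch_pow_inv by blast
  then have n: "cmod (- (lam ^ n)) < \<epsilon>" by (simp add: norm_power)
  obtain h where h: "h \<in> little_lipschitz_space"
    and eq: "\<And>v. h (\<phi> v) - lam * h v - of_bool (v = w)
        = - (lam ^ n) * of_bool (v \<in> {(\<phi> ^^ n) w})"
    using geometric_forward[OF assms(2), of w n] by blast
  have "lipschitz_norm (\<lambda>v. h (\<phi> v) - lam * h v - of_bool (v = w)) < \<epsilon>"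
    unfolding eq by (rule le_less_trans[OF lipschitz_norm_scaled_indicator_le n])
  then show "\<exists>h\<in>little_lipschitz_space.
      lipschitz_norm (\<lambda>v. h (\<phi> v) - lam * h v - of_bool (v = w)) < \<epsilon>"
    using h by blast
qed

lemma dense_range_large:
  assumes "cmod lam > 1"
  shows "dense_range_on_little_lipschitz (\<lambda>f v. comp_op \<phi> f v - lam * f v)"
proof (rule dense_range_comp_op)
  have "lam \<noteq> 0" using assms by auto
  fix w and \<epsilon> :: real assume "\<epsilon> > 0"
  moreover have "1 / cmod lam < 1" using assms by (simp add: divide_less_eq)
  ultimately obtain n where "(1 / cmod lam) ^ n < \<epsilon>"
    using real_arch_pow_inv by blast
  then have n: "cmod (- ((1 / lam) ^ n)) < \<epsilon>" by (simp add: norm_power norm_divide)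
  obtain h where h: "h \<in> little_lipschitz_space"
    and eq: "\<And>v. h (\<phi> v) - lam * h v - of_bool (v = w)
        = - ((1 / lam) ^ n) * of_bool (v \<in> (\<phi> ^^ n) -` {w})"
    using geometric_backward[OF \<open>lam \<noteq> 0\<close>, of w n] by blast
  have "lipschitz_norm (\<lambda>v. h (\<phi> v) - lam * h v - of_bool (v = w)) < \<epsilon>"
    unfolding eq by (rule le_less_trans[OF lipschitz_norm_scaled_indicator_le n])
  then show "\<exists>h\<in>little_lipschitz_space.
      lipschitz_norm (\<lambda>v. h (\<phi> v) - lam * h v - of_bool (v = w)) < \<epsilon>"
    using h by blast
qed

lemma dense_range_vanishing_preimages:
  assumes "lam \<noteq> 0" "\<And>w. \<exists>n. (\<phi> ^^ n) -` {w} = {}"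
  shows "dense_range_on_little_lipschitz (\<lambda>f v. comp_op \<phi> f v - lam * f v)"
proof (rule dense_range_comp_op)
  fix w and \<epsilon> :: real assume e: "\<epsilon> > 0"
  obtain n where n: "(\<phi> ^^ n) -` {w} = {}" using assms(2) by blast
  obtain h where h: "h \<in> little_lipschitz_space"
    and eq: "\<And>v. h (\<phi> v) - lam * h v - of_bool (v = w)
        = - ((1 / lam) ^ n) * of_bool (v \<in> (\<phi> ^^ n) -` {w})"
    using geometric_backward[OF assms(1), of w n] by blast
  \<comment> \<open>With an empty preimage the error function is identically 0, however large the
    power of \<open>1 / lam\<close>.\<close>
  have "lipschitz_norm (\<lambda>v. h (\<phi> v) - lam * h v - of_bool (v = w)) \<le> 0"
    unfolding eq n by (rule lipschitz_norm_leI) auto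
  then show "\<exists>h\<in>little_lipschitz_space.
      lipschitz_norm (\<lambda>v. h (\<phi> v) - lam * h v - of_bool (v = w)) < \<epsilon>"
    using h e by (meson le_less_trans)
qed

end

end

theorem theorem4p3:
  fixes adj :: "'a \<Rightarrow> 'a \<Rightarrow> bool"
    and root :: 'a
    and \<phi> :: "'a \<Rightarrow> 'a"
    and lam :: complex
  assumes "rooted_tree adj root"
    and "rooted_tree.bounded_on_little_lipschitz adj root (comp_op \<phi>)"
    and "(cmod lam < 1 \<and> inj \<phi>) \<or>
         cmod lam > 1 \<or>
         (lam \<noteq> 0 \<and> (\<forall>w. \<exists>n\<ge>1. (\<phi> ^^ n) -` {w} = {}))"
  shows "rooted_tree.dense_range_on_little_lipschitz adj root
           (\<lambda>f v. comp_op \<phi> f v - lam * f v)"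
proof -
  interpret rooted_tree adj root by (rule assms(1))
  have comp: "comp_op \<phi> ` little_lipschitz_space \<subseteq> little_lipschitz_space"
    using assms(2) by (simp add: bounded_on_little_lipschitz_def)
  consider "cmod lam < 1" "inj \<phi>" | "cmod lam > 1"
    | "lam \<noteq> 0" "\<And>w. \<exists>n. (\<phi> ^^ n) -` {w} = {}"
    using assms(3) by metis
  then show ?thesis
  proof cases
    case 1
    then show ?thesis by (rule dense_range_inj[OF comp])
  next
    case 2
    then show ?thesis by (rule dense_range_large[OF comp])
  next
    case 3
    then show ?thesis by (rule dense_range_vanishing_preimages[OF comp])
  qed
qed

end
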